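(* For any radius $R \ge 1/3$, there is a symplectic embedding from $B^4(R)$ into $\Sigma \times B^2(10 R^2)$.
   Context: $B^{2n}(R)$ denotes the open ball of radius $R$ in $\mathbb{R}^{2n}$ with the standard symplectic form $\sum_{i=1}^n dx_i \wedge dy_i$. $\Sigma$ denotes a (connected, orientable) surface of genus 1 with one boundary component, equipped with a symplectic form of total area 1; the paper identifies $\Sigma$ with the torus $T^2(1) = \mathbb{R}^2/\mathbb{Z}^2$ of area 1 with one point removed. $\Sigma \times B^2(10R^2)$ carries the product symplectic form. A symplectic embedding is a smooth embedding that pulls back the symplectic form of the target to the symplectic form of the source. *)

theory Defs
  imports "HOL-Analysis.Analysis"
begin

section \<open>Symplectic planes\<close>

type_synonym plane = "real \<times> real"

definition omega2 :: "plane \<Rightarrow> plane \<Rightarrow> real" where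
  "omega2 u v = fst u * snd v - snd u * fst v"

text \<open>
  Points of \<^typ>\<open>plane \<times> plane\<close> are read as \<open>((x\<^sub>1, y\<^sub>1), (x\<^sub>2, y\<^sub>2))\<close>, and the library norm on
  this type is the Euclidean one.  The form below is the split sum of the two area forms; it is
  at once \<open>dx\<^sub>1 \<and> dy\<^sub>1 + dx\<^sub>2 \<and> dy\<^sub>2\<close> and the product form in the charts of torus times plane.
\<close>

definition omega4 :: "plane \<times> plane \<Rightarrow> plane \<times> plane \<Rightarrow> real" where
  "omega4 u v = omega2 (fst u) (fst v) + omega2 (snd u) (snd v)"


section \<open>Smooth maps on open subsets of Euclidean spaces\<close>

text \<open>Only meaningful for open \<open>S\<close>, since the derivative is taken in a full neighbourhood.\<close>

primrec Ck_on :: "nat \<Rightarrow> 'a::euclidean_space set \<Rightarrow> ('a \<Rightarrow> 'b::euclidean_space) \<Rightarrow> bool" where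
  "Ck_on 0 S f \<longleftrightarrow> continuous_on S f"
| "Ck_on (Suc k) S f \<longleftrightarrow>
     (\<forall>x\<in>S. f differentiable (at x)) \<and>
     (\<forall>v. Ck_on k S (\<lambda>x. frechet_derivative f (at x) v))"

definition smooth_on :: "'a::euclidean_space set \<Rightarrow> ('a \<Rightarrow> 'b::euclidean_space) \<Rightarrow> bool" where
  "smooth_on S f \<longleftrightarrow> (\<forall>k. Ck_on k S f)"


section \<open>The torus of area 1\<close>

definition lattice_rel :: "plane \<Rightarrow> plane \<Rightarrow> bool" where
  "lattice_rel u v \<longleftrightarrow> fst u - fst v \<in> \<int> \<and> snd u - snd v \<in> \<int>"

lemma equivp_lattice_rel: "equivp lattice_rel"
proof (rule equivpI)
  show "reflp lattice_rel"
    by (simp add: reflp_def lattice_rel_def)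
  show "symp lattice_rel"
    by (metis (no_types, lifting) Ints_minus lattice_rel_def minus_diff_eq sympI)
  show "transp lattice_rel"
  proof (rule transpI)
    fix u v w assume "lattice_rel u v" "lattice_rel v w"
    then have "(fst u - fst v) + (fst v - fst w) \<in> \<int>" "(snd u - snd v) + (snd v - snd w) \<in> \<int>"
      by (auto simp only: lattice_rel_def intro: Ints_add)
    then show "lattice_rel u w"
      by (simp add: lattice_rel_def)
  qed
qed

quotient_type torus = plane / lattice_rel
  by (rule equivp_lattice_rel)

instantiation torus :: topological_space
begin

text \<open>The quotient topology.\<close>

definition open_torus :: "torus set \<Rightarrow> bool" where
  "open_torus U \<longleftrightarrow> open (abs_torus -` U)"

instance
  by standard (auto simp: open_torus_def vimage_Union)

end

text \<open>
  The smooth structure and the area form of the torus are those for which the projection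
  \<^const>\<open>abs_torus\<close> is a local symplectomorphism: the charts are the inverses of \<^const>\<open>abs_torus\<close>
  on open sets \<open>V\<close> where it is injective, and in each of them the area form is \<^const>\<open>omega2\<close>.
  The charts of torus times plane are products of these with the identity.
\<close>

definition torus_charts :: "plane set set" where
  "torus_charts = {V. open V \<and> inj_on abs_torus V}"

definition chart_dom :: "plane set \<Rightarrow> (torus \<times> plane) set" where
  "chart_dom V = (abs_torus ` V) \<times> UNIV"

definition chart :: "plane set \<Rightarrow> torus \<times> plane \<Rightarrow> plane \<times> plane" where
  "chart V q = (inv_into V abs_torus (fst q), snd q)"

lemma charts_cover: "\<exists>V\<in>torus_charts. q \<in> chart_dom V"
proof -
  obtain u where u: "fst q = abs_torus u"
    by (metis Quotient3_abs_rep Quotient3_torus)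
  define V where "V = ball u (1/2)"
  have "inj_on abs_torus V"
  proof (rule inj_onI)
    fix v w assume v: "v \<in> V" and w: "w \<in> V" and "abs_torus v = abs_torus w"
    then have rel: "fst v - fst w \<in> \<int>" "snd v - snd w \<in> \<int>"
      by (simp_all add: torus.abs_eq_iff lattice_rel_def)
    have "dist v w < 1"
      using v w dist_triangle_half_r[of u v 1 w] by (simp add: V_def)
    moreover have "\<bar>fst v - fst w\<bar> \<le> dist v w" "\<bar>snd v - snd w\<bar> \<le> dist v w"
      using dist_fst_le[of v w] dist_snd_le[of v w] by (simp_all add: dist_real_def)
    ultimately have "fst v - fst w = 0" "snd v - snd w = 0"
      using rel Ints_nonzero_abs_less1 by force+
    then show "v = w"
      by (simp add: prod_eq_iff)
  qed
  then have "V \<in> torus_charts"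
    by (simp add: torus_charts_def V_def)
  moreover have "q \<in> chart_dom V"
    using u by (auto simp: chart_dom_def V_def mem_Times_iff)
  ultimately show ?thesis by blast
qed

definition punctured_torus :: "torus \<Rightarrow> torus set" where
  "punctured_torus p = - {p}"


section \<open>Symplectic embeddings into torus times plane\<close>

text \<open>
  In what follows \<open>S\<close> is an open subset of the source, so that by continuity the domain
  \<^term>\<open>S \<inter> f -` chart_dom V\<close> of every local expression \<^term>\<open>chart V \<circ> f\<close> is open.
\<close>

definition smooth_map :: "(plane \<times> plane) set \<Rightarrow> (plane \<times> plane \<Rightarrow> torus \<times> plane) \<Rightarrow> bool" where
  "smooth_map S f \<longleftrightarrow>
     continuous_on S f \<and>
     (\<forall>V\<in>torus_charts. smooth_on (S \<inter> f -` chart_dom V) (chart V \<circ> f))"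

definition immersive :: "(plane \<times> plane) set \<Rightarrow> (plane \<times> plane \<Rightarrow> torus \<times> plane) \<Rightarrow> bool" where
  "immersive S f \<longleftrightarrow>
     (\<forall>V\<in>torus_charts. \<forall>x\<in>S \<inter> f -` chart_dom V. inj (frechet_derivative (chart V \<circ> f) (at x)))"

definition smooth_embedding ::
    "(plane \<times> plane) set \<Rightarrow> (torus \<times> plane) set \<Rightarrow> (plane \<times> plane \<Rightarrow> torus \<times> plane) \<Rightarrow> bool" where
  "smooth_embedding S T f \<longleftrightarrow>
     f ` S \<subseteq> T \<and> smooth_map S f \<and> immersive S f \<and> (\<exists>g. homeomorphism S (f ` S) f g)"

definition preserves_form :: "(plane \<times> plane) set \<Rightarrow> (plane \<times> plane \<Rightarrow> torus \<times> plane) \<Rightarrow> bool" where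
  "preserves_form S f \<longleftrightarrow>
     (\<forall>V\<in>torus_charts. \<forall>x\<in>S \<inter> f -` chart_dom V. \<forall>u v.
        omega4 (frechet_derivative (chart V \<circ> f) (at x) u)
               (frechet_derivative (chart V \<circ> f) (at x) v) = omega4 u v)"

definition symplectic_embedding ::
    "(plane \<times> plane) set \<Rightarrow> (torus \<times> plane) set \<Rightarrow> (plane \<times> plane \<Rightarrow> torus \<times> plane) \<Rightarrow> bool" where
  "symplectic_embedding S T f \<longleftrightarrow> smooth_embedding S T f \<and> preserves_form S f"

end

theory Submission
  imports Defs
begin

text \<open>
  Put \<open>a = 2R\<close> and \<open>q\<^sub>i = a x\<^sub>i\<close>, \<open>p\<^sub>i = y\<^sub>i / a\<close>, so that \<open>\<bar>p\<^sub>i\<bar> < 1/2\<close> on the ball and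
  \<open>(q\<^sub>1, q\<^sub>2)\<close> has norm below \<open>2R\<^sup>2\<close>.  The strip of all \<open>(q\<^sub>2, p\<^sub>2)\<close> is wrapped around the torus, and
  its successive turns are separated by moving \<open>p\<^sub>1\<close> up by one unit per turn:
  \<open>(q\<^sub>1, p\<^sub>1, q\<^sub>2, p\<^sub>2) \<mapsto> ((q\<^sub>2, p\<^sub>2 + v'(q\<^sub>2) q\<^sub>1) mod \<int>\<^sup>2, (q\<^sub>1, p\<^sub>1 + v(q\<^sub>2)))\<close>,
  where \<open>v(t + 1) = v(t) + 1\<close>.  The shear of \<open>p\<^sub>2\<close> by \<open>v'(q\<^sub>2) q\<^sub>1\<close> is forced by symplecticity, and it
  is large, so \<open>p\<^sub>2\<close> has to run around the torus too.  It does so without touching the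
  puncture \<open>(0, 1/2)\<close> because \<open>v(t) = t - sin(2\<pi>t)/(2\<pi>)\<close> has \<open>v' = 0\<close> at the integers.
\<close>

section \<open>Calculus of smooth maps\<close>

text \<open>As \<open>S\<close> is open, functions that agree on \<open>S\<close> agree near each of
  its points and so share all derivatives there.\<close>

lemma Ck_on_cong:
  assumes "open S" "Ck_on k S f" "\<And>x. x \<in> S \<Longrightarrow> f x = g x"
  shows "Ck_on k S g"
  using assms(2,3)
proof (induction k arbitrary: f g)
  case 0
  then show ?case by (simp cong: continuous_on_cong)
next
  case (Suc k)
  have D: "(g has_derivative frechet_derivative f (at x)) (at x)" if "x \<in> S" for x
  proof (rule has_derivative_transform_within_open[OF _ \<open>open S\<close> that])
    show "(f has_derivative frechet_derivative f (at x)) (at x)"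
      using Suc.prems(1) that by (simp add: frechet_derivative_works)
  qed (rule Suc.prems(2))
  have "Ck_on k S (\<lambda>x. frechet_derivative g (at x) v)" for v
  proof (rule Suc.IH)
    show "Ck_on k S (\<lambda>x. frechet_derivative f (at x) v)"
      using Suc.prems(1) by simp
    show "frechet_derivative f (at x) v = frechet_derivative g (at x) v" if "x \<in> S" for x
      using frechet_derivative_at[OF D[OF that]] by simp
  qed
  then show ?case
    using D by (auto simp: differentiable_def)
qed

text \<open>Replaces the chosen \<open>frechet_derivative\<close> by an explicit derivative
  \<open>D\<close>, which the inductions below can compute with.\<close>

lemma Ck_on_SucI:
  assumes "open S" "\<And>x. x \<in> S \<Longrightarrow> (f has_derivative D x) (at x)"
    and "\<And>v. Ck_on k S (\<lambda>x. D x v)"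
  shows "Ck_on (Suc k) S f"
proof -
  have "Ck_on k S (\<lambda>x. frechet_derivative f (at x) v)" for v
    using frechet_derivative_at[OF assms(2)] by (intro Ck_on_cong[OF assms(1) assms(3)[of v]]) metis
  then show ?thesis
    using assms(2) by (auto simp: differentiable_def)
qed

lemma Ck_on_SucD:
  assumes "Ck_on (Suc k) S f"
  shows "\<And>x. x \<in> S \<Longrightarrow> (f has_derivative frechet_derivative f (at x)) (at x)"
    and "\<And>v. Ck_on k S (\<lambda>x. frechet_derivative f (at x) v)"
  using assms by (auto simp: frechet_derivative_works)

lemma Ck_on_lower: "Ck_on (Suc k) S f \<Longrightarrow> Ck_on k S f"
proof (induction k arbitrary: f)
  case 0
  then show ?case
    by (auto intro!: continuous_at_imp_continuous_on differentiable_imp_continuous_within)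
next
  case (Suc k)
  then show ?case by (metis Ck_on.simps(2))
qed

lemma Ck_on_subset: "Ck_on k S f \<Longrightarrow> T \<subseteq> S \<Longrightarrow> Ck_on k T f"
  by (induction k arbitrary: f) (auto intro: continuous_on_subset)

text \<open>Allows a local expression to be studied on neighbourhoods \<open>W\<close> that may
  leave \<open>S\<close>, such as those on which a chart differs from the lift by a
  constant.\<close>

lemma Ck_on_local:
  assumes "\<And>x. x \<in> S \<Longrightarrow> \<exists>W. open W \<and> x \<in> W \<and> Ck_on k W f"
  shows "Ck_on k S f"
  using assms
proof (induction k arbitrary: f)
  case 0
  then show ?case
    by (metis Ck_on.simps(1) continuous_at_imp_continuous_on continuous_on_eq_continuous_at)
next
  case (Suc k)
  then show ?case by (metis Ck_on.simps(2))
qed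

lemma Ck_on_const: "open S \<Longrightarrow> Ck_on k S (\<lambda>x. c)"
  by (induction k arbitrary: c) auto

lemma Ck_on_bounded_linear:
  assumes "bounded_linear f" "open S"
  shows "Ck_on k S f"
proof (cases k)
  case 0
  then show ?thesis by (simp add: assms linear_continuous_on)
next
  case (Suc j)
  then show ?thesis
    using assms by (simp only: Suc, intro Ck_on_SucI[where D = "\<lambda>_. f"] Ck_on_const
        bounded_linear_imp_has_derivative)
qed

lemma Ck_on_add:
  assumes "open S" "Ck_on k S f" "Ck_on k S g"
  shows "Ck_on k S (\<lambda>x. f x + g x)"
  using assms(2,3)
proof (induction k arbitrary: f g)
  case 0
  then show ?case by (auto intro: continuous_intros)
next
  case (Suc k)
  show ?case
    by (rule Ck_on_SucI[OF \<open>open S\<close> has_derivative_add[OF Ck_on_SucD(1)[OF Suc.prems(1)]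
            Ck_on_SucD(1)[OF Suc.prems(2)]]
          Suc.IH[OF Ck_on_SucD(2)[OF Suc.prems(1)] Ck_on_SucD(2)[OF Suc.prems(2)]]])
qed

lemma Ck_on_mult:
  fixes f g :: "'a::euclidean_space \<Rightarrow> real"
  assumes "open S" "Ck_on k S f" "Ck_on k S g"
  shows "Ck_on k S (\<lambda>x. f x * g x)"
  using assms(2,3)
proof (induction k arbitrary: f g)
  case 0
  then show ?case by (auto intro: continuous_intros)
next
  case (Suc k)
  note f = Ck_on_SucD[OF Suc.prems(1)] and g = Ck_on_SucD[OF Suc.prems(2)]
  show ?case
    by (rule Ck_on_SucI[OF \<open>open S\<close> has_derivative_mult[OF f(1) g(1)]
          Ck_on_add[OF \<open>open S\<close> Suc.IH[OF Ck_on_lower[OF Suc.prems(1)] g(2)]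
            Suc.IH[OF f(2) Ck_on_lower[OF Suc.prems(2)]]]])
qed

text \<open>The two claims go through one induction because each function appears in the derivative
  of the other.\<close>

lemma Ck_on_sin_cos:
  fixes f :: "'a::euclidean_space \<Rightarrow> real"
  assumes "open S" "Ck_on k S f"
  shows "Ck_on k S (\<lambda>x. sin (f x))" "Ck_on k S (\<lambda>x. cos (f x))"
proof -
  have "Ck_on k S (\<lambda>x. sin (f x)) \<and> Ck_on k S (\<lambda>x. cos (f x))"
    using assms(2)
  proof (induction k)
    case 0
    then show ?case by (auto intro: continuous_intros)
  next
    case (Suc k)
    note f = Ck_on_SucD[OF Suc.prems]
    note IH = Suc.IH[OF Ck_on_lower[OF Suc.prems]]
    have "Ck_on k S (\<lambda>x. (-1) * (sin (f x) * frechet_derivative f (at x) v))" for v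
      using IH f(2) \<open>open S\<close> by (intro Ck_on_mult Ck_on_const) auto
    then have "Ck_on (Suc k) S (\<lambda>x. cos (f x))"
      by (intro Ck_on_SucI[OF \<open>open S\<close>,
            where D = "\<lambda>x v. (-1) * (sin (f x) * frechet_derivative f (at x) v)"])
        (auto intro!: derivative_eq_intros f(1))
    moreover have "Ck_on k S (\<lambda>x. cos (f x) * frechet_derivative f (at x) v)" for v
      using IH f(2) \<open>open S\<close> by (intro Ck_on_mult) auto
    then have "Ck_on (Suc k) S (\<lambda>x. sin (f x))"
      by (intro Ck_on_SucI[OF \<open>open S\<close>,
            where D = "\<lambda>x v. cos (f x) * frechet_derivative f (at x) v"])
        (auto intro!: derivative_eq_intros f(1))
    ultimately show ?case by blast
  qed
  then show "Ck_on k S (\<lambda>x. sin (f x))" "Ck_on k S (\<lambda>x. cos (f x))" by auto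
qed

lemma Ck_on_Pair:
  assumes "open S" "Ck_on k S f" "Ck_on k S g"
  shows "Ck_on k S (\<lambda>x. (f x, g x))"
  using assms(2,3)
proof (induction k arbitrary: f g)
  case 0
  then show ?case by (auto intro: continuous_intros)
next
  case (Suc k)
  show ?case
    by (rule Ck_on_SucI[OF \<open>open S\<close> has_derivative_Pair[OF Ck_on_SucD(1)[OF Suc.prems(1)]
            Ck_on_SucD(1)[OF Suc.prems(2)]]
          Suc.IH[OF Ck_on_SucD(2)[OF Suc.prems(1)] Ck_on_SucD(2)[OF Suc.prems(2)]]])
qed


section \<open>Maps into the torus that lift to the plane\<close>

definition torus_proj :: "plane \<times> plane \<Rightarrow> torus \<times> plane" where
  "torus_proj = map_prod abs_torus id"

section \<open>The projection from the plane to the torus is continuous and open\<close>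

lemma abs_torus_eq_iff: "abs_torus u = abs_torus v \<longleftrightarrow> fst u - fst v \<in> \<int> \<and> snd u - snd v \<in> \<int>"
  by (simp add: torus.abs_eq_iff lattice_rel_def)

lemma abs_torus_surj: "\<exists>u. p = abs_torus u"
  by (metis Quotient3_abs_rep Quotient3_torus)

lemma continuous_abs_torus: "continuous_on UNIV abs_torus"
  by (simp add: continuous_on_open_vimage open_torus_def)

text \<open>The preimage of the image is the union of all integer translates of \<open>U\<close>,
  each of them open.\<close>

lemma open_abs_torus_image:
  assumes "open U"
  shows "open (abs_torus ` U)"
proof -
  have "abs_torus -` (abs_torus ` U) = (\<Union>w\<in>\<int> \<times> \<int>. (+) w ` U)"
  proof (intro equalityI subsetI)
    fix x assume "x \<in> abs_torus -` (abs_torus ` U)"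
    then obtain u where "u \<in> U" "x - u \<in> \<int> \<times> \<int>"
      by (auto simp: abs_torus_eq_iff mem_Times_iff)
    then show "x \<in> (\<Union>w\<in>\<int> \<times> \<int>. (+) w ` U)"
      by (intro UN_I[of "x - u"] image_eqI[of _ _ u]) auto
  next
    fix x assume "x \<in> (\<Union>w\<in>\<int> \<times> \<int>. (+) w ` U)"
    then show "x \<in> abs_torus -` (abs_torus ` U)"
      by (force simp: abs_torus_eq_iff)
  qed
  then show ?thesis
    using assms by (auto simp: open_torus_def intro: open_translation)
qed

lemma open_torus_proj_image:
  assumes "open U"
  shows "open (torus_proj ` U)"
proof (subst open_prod_def, intro ballI)
  fix y assume "y \<in> torus_proj ` U"
  then obtain x where x: "x \<in> U" "y = torus_proj x" by blast
  then obtain A B where "open A" "open B" "x \<in> A \<times> B" "A \<times> B \<subseteq> U"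
    using assms by (metis open_prod_elim)
  then show "\<exists>A B. open A \<and> open B \<and> y \<in> A \<times> B \<and> A \<times> B \<subseteq> torus_proj ` U"
    using x by (intro exI[of _ "abs_torus ` A"] exI[of _ B])
      (force simp: torus_proj_def open_abs_torus_image)
qed

lemma continuous_torus_proj: "continuous_on UNIV torus_proj"
  unfolding torus_proj_def map_prod_def case_prod_unfold
  by (intro continuous_on_Pair continuous_on_compose2[OF continuous_abs_torus])
    (auto intro: continuous_intros)

text \<open>A chart inverts \<open>abs_torus\<close>, so near \<open>x\<close> it can differ from
  the lift \<open>G\<close> only by a fixed lattice translation. Local expressions therefore have
  the derivatives of \<open>G\<close>.\<close>

lemma chart_eq_lift_plus_const:
  fixes G :: "plane \<times> plane \<Rightarrow> plane \<times> plane"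
  assumes "continuous_on UNIV G" "V \<in> torus_charts" and x: "torus_proj (G x) \<in> chart_dom V"
  obtains W c where "open W" "x \<in> W" "\<And>y. y \<in> W \<Longrightarrow> (chart V \<circ> (torus_proj \<circ> G)) y = G y + c"
proof -
  have V: "open V" "inj_on abs_torus V"
    using \<open>V \<in> torus_charts\<close> by (auto simp: torus_charts_def)
  have "abs_torus (fst (G x)) \<in> abs_torus ` V"
    using x by (simp add: chart_dom_def torus_proj_def mem_Times_iff)
  then obtain u where u: "u \<in> V" "abs_torus (fst (G x)) = abs_torus u"
    by blast
  define c where "c = u - fst (G x)"
  \<comment> \<open>On \<open>W\<close> the lift translated by the lattice vector \<open>c\<close>
    stays in \<open>V\<close>, where \<open>inv_into\<close> undoes
    \<open>abs_torus\<close>.\<close>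
  define W where "W = (\<lambda>y. fst (G y) + c) -` V"
  have "open W"
    unfolding W_def
    by (intro open_vimage[OF \<open>open V\<close>] continuous_intros continuous_on_compose2[OF _ assms(1)]) auto
  moreover have "x \<in> W"
    using u by (simp add: W_def c_def)
  moreover have "(chart V \<circ> (torus_proj \<circ> G)) y = G y + (c, 0)" if "y \<in> W" for y
  proof -
    have "abs_torus (fst (G y)) = abs_torus (fst (G y) + c)"
      using u(2) by (auto simp: abs_torus_eq_iff c_def)
    then have "inv_into V abs_torus (abs_torus (fst (G y))) = fst (G y) + c"
      using that V by (simp add: W_def)
    then show ?thesis
      by (simp add: chart_def torus_proj_def prod_eq_iff)
  qed
  ultimately show thesis by (rule that)
qed

lemma frechet_derivative_chart_lift:
  fixes G :: "plane \<times> plane \<Rightarrow> plane \<times> plane"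
  assumes "(G has_derivative D) (at x)" "continuous_on UNIV G" "V \<in> torus_charts"
    and "torus_proj (G x) \<in> chart_dom V"
  shows "frechet_derivative (chart V \<circ> (torus_proj \<circ> G)) (at x) = D"
proof -
  obtain W c where W: "open W" "x \<in> W" "\<And>y. y \<in> W \<Longrightarrow> (chart V \<circ> (torus_proj \<circ> G)) y = G y + c"
    using chart_eq_lift_plus_const[OF assms(2-4)] by blast
  have "((\<lambda>y. G y + c) has_derivative D) (at x)"
    using assms(1) by (auto intro!: derivative_eq_intros)
  then have "((chart V \<circ> (torus_proj \<circ> G)) has_derivative D) (at x)"
    by (rule has_derivative_transform_within_open[OF _ W(1,2) W(3)[symmetric]])
  then show ?thesis
    using frechet_derivative_at by metis
qed

lemma smooth_map_torus_proj:
  assumes "smooth_on UNIV G" "open S"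
  shows "smooth_map S (torus_proj \<circ> G)"
proof -
  have G: "continuous_on UNIV G"
    using assms(1) by (metis Ck_on.simps(1) smooth_on_def)
  have "Ck_on k (S \<inter> (torus_proj \<circ> G) -` chart_dom V) (chart V \<circ> (torus_proj \<circ> G))"
    if V: "V \<in> torus_charts" for V k
  proof (rule Ck_on_local)
    fix x assume "x \<in> S \<inter> (torus_proj \<circ> G) -` chart_dom V"
    then have "torus_proj (G x) \<in> chart_dom V" by simp
    then obtain W c where W: "open W" "x \<in> W"
        "\<And>y. y \<in> W \<Longrightarrow> (chart V \<circ> (torus_proj \<circ> G)) y = G y + c"
      using chart_eq_lift_plus_const[OF G V] by blast
    have "Ck_on k W (\<lambda>y. G y + c)"
    proof (intro Ck_on_add Ck_on_const W(1))
      show "Ck_on k W G"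
        using assms(1) by (auto simp only: smooth_on_def intro: Ck_on_subset[OF _ subset_UNIV])
    qed
    then have "Ck_on k W (chart V \<circ> (torus_proj \<circ> G))"
      by (rule Ck_on_cong[OF W(1)]) (simp only: W(3))
    then show "\<exists>W. open W \<and> x \<in> W \<and> Ck_on k W (chart V \<circ> (torus_proj \<circ> G))"
      using W(1,2) by blast
  qed
  moreover have "continuous_on S (torus_proj \<circ> G)"
    by (intro continuous_on_compose continuous_on_subset[OF G]
        continuous_on_subset[OF continuous_torus_proj]) auto
  ultimately show ?thesis
    by (auto simp: smooth_map_def smooth_on_def)
qed

lemma omega4_nondegenerate:
  assumes "\<And>v. omega4 u v = 0"
  shows "u = 0"
  using assms[of "((1,0),0)"] assms[of "((0,1),0)"] assms[of "(0,(1,0))"] assms[of "(0,(0,1))"]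
  by (simp add: omega4_def omega2_def prod_eq_iff)

text \<open>Moves all differential conditions to the lift \<open>G\<close>; only injectivity and the
  target are checked after projecting. Immersivity comes for free: a vector in the kernel of
  \<open>D x\<close> pairs to zero with every vector, against the nondegeneracy of
  \<open>omega4\<close>.\<close>

lemma symplectic_embedding_torus_proj:
  assumes G: "smooth_on UNIV G" "inj G" and "open S"
    and inj: "inj_on (torus_proj \<circ> G) S" and T: "(torus_proj \<circ> G) ` S \<subseteq> T"
    and D: "\<And>x. x \<in> S \<Longrightarrow> (G has_derivative D x) (at x)"
    and symp: "\<And>x u v. x \<in> S \<Longrightarrow> omega4 (D x u) (D x v) = omega4 u v"
  shows "symplectic_embedding S T (torus_proj \<circ> G)"
proof -
  have contG: "continuous_on UNIV G"
    using G(1) by (metis Ck_on.simps(1) smooth_on_def)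
  have fd: "frechet_derivative (chart V \<circ> (torus_proj \<circ> G)) (at x) = D x"
    if "V \<in> torus_charts" "x \<in> S \<inter> (torus_proj \<circ> G) -` chart_dom V" for V x
    using frechet_derivative_chart_lift[OF D contG] that by auto
  have "inj (D x)" if x: "x \<in> S" for x
  proof -
    have lin: "linear (D x)"
      using D[OF x] has_derivative_linear by blast
    show ?thesis
    proof (subst linear_injective_0[OF lin], intro allI impI)
      fix u assume u: "D x u = 0"
      have "omega4 u v = 0" for v
        using symp[OF x, of u v] by (simp add: u omega4_def omega2_def)
      then show "u = 0" by (rule omega4_nondegenerate)
    qed
  qed
  then have "immersive S (torus_proj \<circ> G)"
    by (auto simp: immersive_def fd)
  moreover have "preserves_form S (torus_proj \<circ> G)"
    by (auto simp: preserves_form_def fd symp)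
  moreover have smooth: "smooth_map S (torus_proj \<circ> G)"
    using smooth_map_torus_proj[OF G(1) \<open>open S\<close>] .
  moreover have "\<exists>g. homeomorphism S ((torus_proj \<circ> G) ` S) (torus_proj \<circ> G) g"
  proof (rule homeomorphism_injective_open_map[OF _ refl inj])
    show "continuous_on S (torus_proj \<circ> G)"
      using smooth by (simp add: smooth_map_def)
    fix U assume "openin (top_of_set S) U"
    then have U: "open U" "U \<subseteq> S"
      using openin_open_eq[OF \<open>open S\<close>] by auto
    \<comment> \<open>Invariance of domain applies since \<open>G\<close> is continuous and
      injective between spaces of equal dimension. As \<open>torus_proj\<close> is open too, the
      composite is an open map, which makes its inverse continuous.\<close>
    have "open (G ` U)"
      using invariance_of_domain[of U G] U(1) G(2) contG
      by (meson continuous_on_subset inj_on_subset subset_UNIV)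
    then have "open ((torus_proj \<circ> G) ` U)"
      by (simp only: image_comp[symmetric] open_torus_proj_image)
    then show "openin (top_of_set ((torus_proj \<circ> G) ` S)) ((torus_proj \<circ> G) ` U)"
      using U(2) by (metis image_mono open_subset)
  qed blast
  ultimately show ?thesis
    using T by (simp add: symplectic_embedding_def smooth_embedding_def)
qed


section \<open>The wrapping map\<close>

definition stair :: "real \<Rightarrow> real" where
  "stair t = t - sin (2 * pi * t) / (2 * pi)"

definition stair' :: "real \<Rightarrow> real" where
  "stair' t = 1 - cos (2 * pi * t)"

lemma stair_add_int:
  assumes "n \<in> \<int>"
  shows "stair (t + n) = stair t + n"
  using assms by (auto elim!: Ints_cases simp: stair_def distrib_left sin_add)

lemma stair'_int:
  assumes "n \<in> \<int>"
  shows "stair' n = 0"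
  using assms by (auto elim!: Ints_cases simp: stair'_def)

lemma stair_near: "\<bar>stair t - t\<bar> \<le> 1 / 6"
proof -
  have "\<bar>sin (2 * pi * t)\<bar> / (2 * pi) \<le> 1 / (2 * 3)"
    using pi_gt3 by (intro frac_le) auto
  then show ?thesis by (simp add: stair_def abs_mult)
qed

text \<open>Up to the scaling, the exchange of the two factors and the translation \<open>c\<close>,
  this is p \<mapsto> p + grad F(q) with F(q1, q2) = q1 * \<open>stair\<close> q2. The parameter
  \<open>c\<close> serves to place the missed point of the torus.\<close>

definition wrap :: "real \<Rightarrow> plane \<Rightarrow> plane \<times> plane \<Rightarrow> plane \<times> plane" where
  "wrap a c z = (case z of ((x1, y1), (x2, y2)) \<Rightarrow>
     (c + (a * x2, y2 / a + stair' (a * x2) * (a * x1)), (a * x1, y1 / a + stair (a * x2))))"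

definition wrap_deriv :: "real \<Rightarrow> plane \<times> plane \<Rightarrow> plane \<times> plane \<Rightarrow> plane \<times> plane" where
  "wrap_deriv a z u = (case (z, u) of (((x1, y1), (x2, y2)), ((s1, t1), (s2, t2))) \<Rightarrow>
     ((a * s2, t2 / a + (2 * pi * sin (2 * pi * (a * x2)) * (a * s2) * (a * x1)
                         + stair' (a * x2) * (a * s1))),
      (a * s1, t1 / a + stair' (a * x2) * (a * s2))))"

lemma wrap_alt:
  "wrap a c = (\<lambda>z. (c + (a * fst (snd z), snd (snd z) / a + stair' (a * fst (snd z)) * (a * fst (fst z))),
     (a * fst (fst z), snd (fst z) / a + stair (a * fst (snd z)))))"
  by (auto simp: wrap_def fun_eq_iff)

lemma wrap_has_derivative: "a \<noteq> 0 \<Longrightarrow> (wrap a c has_derivative wrap_deriv a z) (at z)"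
  unfolding wrap_alt stair_def stair'_def
  by (auto intro!: derivative_eq_intros
      simp: wrap_deriv_def stair'_def fun_eq_iff case_prod_unfold algebra_simps)

text \<open>The Hessian of F is symmetric: the mixed terms with \<open>stair'\<close> from the two
  planes cancel, and the term with the sine cancels by antisymmetry within the first plane.\<close>

lemma wrap_deriv_symplectic:
  "a \<noteq> 0 \<Longrightarrow> omega4 (wrap_deriv a z u) (wrap_deriv a z v) = omega4 u v"
  by (simp add: omega4_def omega2_def wrap_deriv_def case_prod_unfold field_simps)

lemma smooth_wrap: "smooth_on UNIV (wrap a c)"
proof -
  have coord: "Ck_on k UNIV (\<lambda>z. r * fst (snd z))" "Ck_on k UNIV (\<lambda>z. r * fst (fst z))"
    "Ck_on k UNIV (\<lambda>z. r * snd (snd z))" "Ck_on k UNIV (\<lambda>z. r * snd (fst z))"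
    for k and r :: real and z :: "plane \<times> plane"
    by (auto intro!: Ck_on_bounded_linear bounded_linear_const_mult bounded_linear_fst_comp
        bounded_linear_snd_comp bounded_linear_fst bounded_linear_snd)
  \<comment> \<open>Divisions and differences become products with constants and sums, the shapes
    for which closure of \<open>Ck_on\<close> was shown.\<close>
  have "wrap a c = (\<lambda>z. (c + (a * fst (snd z),
        (1 / a) * snd (snd z) + (1 + (-1) * cos ((2 * pi * a) * fst (snd z))) * (a * fst (fst z))),
     (a * fst (fst z), (1 / a) * snd (fst z) +
        (a * fst (snd z) + (- 1 / (2 * pi)) * sin ((2 * pi * a) * fst (snd z))))))"
    by (simp add: wrap_alt stair_def stair'_def fun_eq_iff mult.assoc)
  moreover have "Ck_on k UNIV \<dots>" for k
    by (intro Ck_on_Pair Ck_on_add Ck_on_mult Ck_on_sin_cos Ck_on_const coord open_UNIV)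
  ultimately show ?thesis
    by (simp add: smooth_on_def)
qed

section \<open>Injectivity, the puncture and the size of the image\<close>

lemma inj_wrap: "a \<noteq> 0 \<Longrightarrow> inj (wrap a c)"
  by (rule injI) (auto simp: wrap_def)

lemma inj_on_torus_proj_wrap:
  assumes "a > 0" and S: "\<And>z. z \<in> S \<Longrightarrow> \<bar>snd (fst z)\<bar> < a / 2 \<and> \<bar>snd (snd z)\<bar> < a / 2"
  shows "inj_on (torus_proj \<circ> wrap a c) S"
proof (rule inj_onI)
  fix z w assume zw: "z \<in> S" "w \<in> S" and eq: "(torus_proj \<circ> wrap a c) z = (torus_proj \<circ> wrap a c) w"
  obtain x1 y1 x2 y2 where z: "z = ((x1, y1), (x2, y2))" by (metis prod.exhaust)
  obtain s1 t1 s2 t2 where w: "w = ((s1, t1), (s2, t2))" by (metis prod.exhaust)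
  have small: "\<bar>y1 / a - t1 / a\<bar> < 1" "\<bar>y2 / a - t2 / a\<bar> < 1"
    using S[OF zw(1)] S[OF zw(2)] \<open>a > 0\<close> by (auto simp: z w field_simps abs_less_iff)
  from eq \<open>a > 0\<close> have e: "x1 = s1" "y1 / a + stair (a * x2) = t1 / a + stair (a * s2)"
    "a * x2 - a * s2 \<in> \<int>"
    "(y2 / a + stair' (a * x2) * (a * x1)) - (t2 / a + stair' (a * s2) * (a * s1)) \<in> \<int>"
    by (auto simp: z w wrap_def torus_proj_def abs_torus_eq_iff)
  \<comment> \<open>If two points lie n turns apart, then \<open>stair\<close> differs by exactly n,
    and only a difference of n in \<open>y / a\<close> could compensate. These values differ by less
    than 1, so n = 0.\<close>
  have "stair (a * x2) = stair (a * s2) + (a * x2 - a * s2)"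
    using stair_add_int[OF e(3), of "a * s2"] by simp
  then have "a * x2 - a * s2 = t1 / a - y1 / a"
    using e(2) by simp
  then have "a * x2 - a * s2 = 0"
    using e(3) small(1) Ints_nonzero_abs_less1 by fastforce
  then have x2: "x2 = s2" using \<open>a > 0\<close> by simp
  then have "y1 = t1" using e(2) \<open>a > 0\<close> by simp
  \<comment> \<open>With equal x-coordinates the two shears coincide and drop out, however large
    they are.\<close>
  have "y2 / a - t2 / a \<in> \<int>"
    using e(4) by (simp add: x2 e(1))
  then have "y2 / a - t2 / a = 0"
    using small(2) Ints_nonzero_abs_less1 by blast
  then have "y2 = t2" using \<open>a > 0\<close> by simp
  then show "z = w" using z w e(1) x2 \<open>y1 = t1\<close> by simp
qed

text \<open>Hitting this point forces \<open>a * x2\<close> to be an integer. The shear vanishes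
  there, so \<open>y2 / a\<close> would have to be a half-integer, although it lies strictly between
  -1/2 and 1/2.\<close>

lemma wrap_avoids_puncture:
  assumes "a > 0" "\<bar>snd (snd z)\<bar> < a / 2"
  shows "abs_torus (fst (wrap a c z)) \<noteq> abs_torus (c + (0, 1 / 2))"
proof
  obtain x1 y1 x2 y2 where z: "z = ((x1, y1), (x2, y2))" by (metis prod.exhaust)
  assume "abs_torus (fst (wrap a c z)) = abs_torus (c + (0, 1 / 2))"
  then have e: "a * x2 \<in> \<int>" "y2 / a + stair' (a * x2) * (a * x1) - 1 / 2 \<in> \<int>"
    by (auto simp: z wrap_def abs_torus_eq_iff algebra_simps)
  then have "y2 / a - 1 / 2 \<in> \<int>"
    by (simp add: stair'_int)
  moreover have "-1 < y2 / a - 1 / 2" "y2 / a - 1 / 2 < 0"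
    using assms by (auto simp: z field_simps)
  ultimately show False
    using Ints_nonzero_abs_less1[of "y2 / a - 1 / 2"] by auto
qed

text \<open>The second component is close to \<open>a *\<^sub>R (x1, x2)\<close>: the error is below
  1/2 from \<open>y1 / a\<close> plus at most 1/6 from \<open>stair_near\<close>, hence the
  2/3.\<close>

lemma norm_snd_wrap:
  assumes "a > 0" "\<bar>snd (fst z)\<bar> < a / 2"
  shows "norm (snd (wrap a c z)) < a * norm z + 2 / 3"
proof -
  obtain x1 y1 x2 y2 where z: "z = ((x1, y1), (x2, y2))" by (metis prod.exhaust)
  have "snd (wrap a c z) = a *\<^sub>R (x1, x2) + (0, y1 / a + (stair (a * x2) - a * x2))"
    by (simp add: z wrap_def)
  then have "norm (snd (wrap a c z)) \<le>
      norm (a *\<^sub>R (x1, x2)) + norm (0 :: real, y1 / a + (stair (a * x2) - a * x2))"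
    by (simp only: norm_triangle_ineq)
  then have "norm (snd (wrap a c z)) \<le> a * norm (x1, x2) + \<bar>y1 / a + (stair (a * x2) - a * x2)\<bar>"
    using \<open>a > 0\<close> by (simp only: norm_scaleR norm_Pair2) simp
  moreover have "\<bar>y1 / a\<bar> < 1 / 2"
    using assms by (auto simp: z field_simps)
  then have "\<bar>y1 / a + (stair (a * x2) - a * x2)\<bar> < 2 / 3"
    using stair_near[of "a * x2"] by linarith
  moreover have "norm (x1, x2) \<le> norm z"
    by (auto simp: z norm_Pair intro!: real_sqrt_le_mono)
  then have "a * norm (x1, x2) \<le> a * norm z"
    using \<open>a > 0\<close> by simp
  ultimately show ?thesis by linarith
qed

theorem mainTheorem3:
  fixes R :: real and p :: torus
  assumes "R \<ge> 1/3"
  shows "\<exists>f. symplectic_embedding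
               (ball (0 :: plane \<times> plane) R)
               (punctured_torus p \<times> ball (0 :: plane) (10 * R\<^sup>2)) f"
proof -
  \<comment> \<open>With this scale the bound R on the y-coordinates becomes 1/2 after division by
    \<open>a\<close>.\<close>
  define a where "a = 2 * R"
  have a: "a > 0" using assms by (simp add: a_def)
  obtain u where u: "p = abs_torus u" using abs_torus_surj by blast
  \<comment> \<open>\<open>wrap a c\<close> misses the class of \<open>c + (0, 1 / 2)\<close>, which
    this choice makes equal to \<open>p\<close>.\<close>
  define c where "c = u - (0, 1 / 2)"
  have small: "\<bar>snd (fst z)\<bar> < a / 2 \<and> \<bar>snd (snd z)\<bar> < a / 2" if "z \<in> ball 0 R" for z :: "plane \<times> plane"
    using that norm_fst_le[of "fst z" "snd z"] norm_snd_le[of "snd z" "fst z"]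
      norm_snd_le[of "snd (fst z)" "fst (fst z)"] norm_snd_le[of "snd (snd z)" "fst (snd z)"]
    by (simp add: a_def)
  have "(torus_proj \<circ> wrap a c) z \<in> punctured_torus p \<times> ball 0 (10 * R\<^sup>2)" if z: "z \<in> ball 0 R" for z
  proof -
    have "(1 / 3)\<^sup>2 \<le> R\<^sup>2"
      using assms by (intro power_mono) auto
    \<comment> \<open>As \<open>a * R\<close> is twice the square of R, the claim is that 8 times
      this square is at least 2/3; it is at least 8/9.\<close>
    then have "a * R + 2 / 3 \<le> 10 * R\<^sup>2"
      by (simp add: a_def power2_eq_square)
    moreover have "norm (snd (wrap a c z)) < a * norm z + 2 / 3"
      using norm_snd_wrap[OF a] small[OF z] by blast
    moreover have "a * norm z \<le> a * R"
      using z a by simp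
    ultimately have "norm (snd (wrap a c z)) < 10 * R\<^sup>2" by linarith
    moreover have "abs_torus (fst (wrap a c z)) \<noteq> p"
      using wrap_avoids_puncture[OF a] small[OF z] by (metis c_def diff_add_cancel u)
    ultimately show ?thesis
      by (simp add: torus_proj_def punctured_torus_def mem_Times_iff)
  qed
  then have "(torus_proj \<circ> wrap a c) ` ball 0 R \<subseteq> punctured_torus p \<times> ball 0 (10 * R\<^sup>2)"
    by (rule image_subsetI)
  then have "symplectic_embedding (ball 0 R) (punctured_torus p \<times> ball 0 (10 * R\<^sup>2))
      (torus_proj \<circ> wrap a c)"
    using a by (intro symplectic_embedding_torus_proj[OF smooth_wrap inj_wrap open_ball
          inj_on_torus_proj_wrap[OF a small] _ wrap_has_derivative wrap_deriv_symplectic]) auto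
  then show ?thesis by blast
qed

end
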